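(* Let $\mathbb{K}=\mathbb{R}$ or $\mathbb{C}$, let $n\geq 1$, and let $\mathcal{G}$ be an abelian subgroup of $GL(n,\mathbb{K})$. Then there exists a $\mathcal{G}$-invariant, dense open set $U$ in $\mathbb{K}^{n}$ with the following properties: i) Every orbit of $\mathcal{G}$ contained in $U$ is minimal in $U$. ii) $\mathbb{K}^{n}-U$ is a union of at most $n$ $\mathcal{G}$-invariant vector subspaces of $\mathbb{K}^{n}$, each of dimension $n-1$ or $n-2$ over $\mathbb{K}$.
   Context: $\mathcal{G}$ acts linearly on $\mathbb{K}^n$ by $(A,v)\mapsto Av$; no topological assumption (such as closedness or discreteness) is made on $\mathcal{G}$. The orbit of $v\in\mathbb{K}^n$ is $\mathcal{G}(v)=\{Av : A\in\mathcal{G}\}$. A subset $E\subset\mathbb{K}^n$ is $\mathcal{G}$-invariant if $A(E)\subset E$ for every $A\in\mathcal{G}$, i.e. $E$ is a union of orbits. If $V$ is a $\mathcal{G}$-invariant open set in $\mathbb{K}^n$, a minimal set in $V$ is a non-empty $\mathcal{G}$-invariant subset $E\subset V$, closed in $V$, which has no proper subset with these properties (equivalently, every orbit contained in $E$ is dense in $E$). An orbit $O\subset V$ is called minimal in $V$ if $\overline{O}\cap V$ is a minimal set in $V$, where $\overline{O}$ is the closure of $O$ in $\mathbb{K}^n$. *)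

theory Defs
  imports "HOL-Analysis.Analysis" "HOL-Algebra.Group"
begin

definition GL :: "('a::field ^ 'n ^ 'n) monoid"
  where "GL = \<lparr>carrier = {A. invertible A}, mult = (**), one = mat 1\<rparr>"

definition abelian_subgroup_GL :: "('a::field ^ 'n ^ 'n) set \<Rightarrow> bool"
  where "abelian_subgroup_GL G \<longleftrightarrow> subgroup G GL \<and> comm_group (GL\<lparr>carrier := G\<rparr>)"

lemma group_GL: "group (GL :: ('a::field ^ 'n ^ 'n) monoid)"
proof (rule groupI)
  fix A :: "'a ^ 'n ^ 'n"
  assume "A \<in> carrier GL"
  then obtain B where "A ** B = mat 1" "B ** A = mat 1"
    by (auto simp: GL_def invertible_def)
  then show "\<exists>B\<in>carrier GL. B \<otimes>\<^bsub>GL\<^esub> A = \<one>\<^bsub>GL\<^esub>"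
    by (auto simp: GL_def invertible_def)
qed (auto simp: GL_def invertible_mult matrix_mul_assoc, auto simp: invertible_def)

definition linear_orbit :: "('a::field ^ 'n ^ 'n) set \<Rightarrow> 'a ^ 'n \<Rightarrow> ('a ^ 'n) set"
  where "linear_orbit G v = {A *v v | A. A \<in> G}"

definition invariant_under :: "('a::field ^ 'n ^ 'n) set \<Rightarrow> ('a ^ 'n) set \<Rightarrow> bool"
  where "invariant_under G E \<longleftrightarrow> (\<forall>A\<in>G. (\<lambda>v. A *v v) ` E \<subseteq> E)"

definition closed_invariant_in ::
  "('a::real_normed_field ^ 'n ^ 'n) set \<Rightarrow> ('a ^ 'n) set \<Rightarrow> ('a ^ 'n) set \<Rightarrow> bool"
  where "closed_invariant_in G V E \<longleftrightarrow>
    E \<noteq> {} \<and> E \<subseteq> V \<and> invariant_under G E \<and> closedin (top_of_set V) E"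

definition minimal_set_in ::
  "('a::real_normed_field ^ 'n ^ 'n) set \<Rightarrow> ('a ^ 'n) set \<Rightarrow> ('a ^ 'n) set \<Rightarrow> bool"
  where "minimal_set_in G V E \<longleftrightarrow>
    closed_invariant_in G V E \<and> (\<nexists>F. F \<subset> E \<and> closed_invariant_in G V F)"

definition minimal_orbit_in ::
  "('a::real_normed_field ^ 'n ^ 'n) set \<Rightarrow> ('a ^ 'n) set \<Rightarrow> ('a ^ 'n) set \<Rightarrow> bool"
  where "minimal_orbit_in G V O' \<longleftrightarrow> O' \<subseteq> V \<and> minimal_set_in G V (closure O' \<inter> V)"

text \<open>
  The operations \<open>vec.subspace\<close> and \<open>vec.dim\<close> refer to the vector space over the field of the
  entries. The unqualified \<open>subspace\<close> and \<open>dim\<close> would be taken over the reals also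
  for complex vectors. The dimension conditions are stated additively since
  subtraction on \<open>nat\<close> truncates: codimension 2 must be impossible for \<open>n = 1\<close>.
\<close>

definition invariant_subspace_codim_1_2 ::
  "('a::field ^ 'n ^ 'n) set \<Rightarrow> ('a ^ 'n) set \<Rightarrow> bool"
  where "invariant_subspace_codim_1_2 G W \<longleftrightarrow>
    vec.subspace W \<and> invariant_under G W \<and>
    (vec.dim W + 1 = CARD('n) \<or> vec.dim W + 2 = CARD('n))"

end

theory Submission
  imports Defs "HOL-Computational_Algebra.Fundamental_Theorem_Algebra"
begin

text \<open>
  Let \<open>\<A>\<close> be the unital algebra generated by \<open>G\<close>; it is commutative. Everything rests on one sufficient
  condition on \<open>U\<close>: whenever \<open>v\<close> and \<open>P v\<close> both lie in \<open>U\<close> for some \<open>P \<in> \<A>\<close>, the matrix \<open>P\<close> is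
  invertible.

  Why this makes orbits minimal: let \<open>w \<in> U\<close> be a limit of points \<open>A\<^sub>m v\<close> of the orbit of \<open>v \<in> U\<close>. The
  subspace \<open>\<A> v\<close> is finite-dimensional, hence closed, so \<open>w = P v\<close> with \<open>P \<in> \<A>\<close>, and \<open>P\<close> is
  invertible. Commutativity upgrades the convergence \<open>A\<^sub>m v \<longlonglongrightarrow> P v\<close> at the single vector \<open>v\<close> to
  convergence of the operators \<open>A\<^sub>m\<close> to \<open>P\<close> on the whole of \<open>\<A> v\<close>, since
  \<open>A\<^sub>m Q v = Q A\<^sub>m v \<longlonglongrightarrow> Q P v = P Q v\<close>. As the limit is invertible, the inverses converge as well, and
  \<open>A\<^sub>m\<^sup>-\<^sup>1 w \<longlonglongrightarrow> v\<close>. Thus \<open>v\<close> lies in the closure of the orbit of \<open>w\<close>: being in the orbit closure is a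
  symmetric relation on \<open>U\<close> (\<open>orbit_closure_symmetric\<close>), which is minimality.

  How to find \<open>U\<close>: the image of a noninvertible \<open>P \<in> \<A>\<close> is a proper invariant subspace, hence is
  contained in a maximal one. It suffices to remove from the space at most \<open>n\<close> maximal invariant
  subspaces such that the image of every noninvertible \<open>P\<close> lies in one of them
  (\<open>finite_cover_of_noninvertible\<close>). The quotient by a maximal invariant subspace is a simple module
  over a commutative algebra, so by the factorization of polynomials it has dimension 1 over the
  complex numbers and dimension 1 or 2 over the real numbers (\<open>codim_of_maximal_complex\<close>,
  \<open>codim_of_maximal_real\<close>).
\<close>

section \<open>The commutative algebra generated by the group\<close>

lemma mat_mult_vec: "mat c *v x = c *s (x :: 'a::semiring_1 ^ 'n)"
  by (simp add: vec_eq_iff matrix_vector_mult_def mat_def if_distrib[of "\<lambda>t. t * _"] cong: if_cong)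

lemma mat_commute: "mat c ** A = A ** mat (c :: 'a::comm_semiring_1)"
  by (simp add: vec_eq_iff matrix_matrix_mult_def mat_def mult.commute
      if_distrib[of "\<lambda>t. t * _"] if_distrib[of "\<lambda>t. _ * t"] cong: if_cong)

lemma matrix_add_rdistrib: "(B + C) ** A = B ** A + C ** (A :: 'a::semiring_1 ^ 'n ^ 'm)"
  by (simp add: vec_eq_iff matrix_matrix_mult_def distrib_right sum.distrib)

text \<open>
  Scalars enter as the matrices \<open>mat c\<close>, so that scalar multiplication is a case of multiplication and
  the algebra is unital.
\<close>

inductive_set generated_alg :: "('a::field ^ 'n ^ 'n) set \<Rightarrow> ('a ^ 'n ^ 'n) set" for G where
  gen: "A \<in> G \<Longrightarrow> A \<in> generated_alg G"
| scalar: "mat c \<in> generated_alg G"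
| add: "P \<in> generated_alg G \<Longrightarrow> Q \<in> generated_alg G \<Longrightarrow> P + Q \<in> generated_alg G"
| mult: "P \<in> generated_alg G \<Longrightarrow> Q \<in> generated_alg G \<Longrightarrow> P ** Q \<in> generated_alg G"

definition pairwise_commuting :: "('a::field ^ 'n ^ 'n) set \<Rightarrow> bool"
  where "pairwise_commuting G \<longleftrightarrow> (\<forall>A\<in>G. \<forall>B\<in>G. A ** B = B ** A)"

lemma pairwise_commuting_generated_alg:
  assumes "pairwise_commuting G"
  shows "pairwise_commuting (generated_alg G)"
proof -
  have 1: "P ** A = A ** P" if "P \<in> generated_alg G" "A \<in> G" for P A
    using that
  proof induction
    case (gen B) then show ?case using assms by (simp add: pairwise_commuting_def)
  next
    case (scalar c) then show ?case by (simp add: mat_commute)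
  next
    case (add P Q) then show ?case by (simp add: matrix_add_ldistrib matrix_add_rdistrib)
  next
    case (mult P Q) then show ?case by (metis matrix_mul_assoc)
  qed
  have "P ** Q = Q ** P" if "P \<in> generated_alg G" "Q \<in> generated_alg G" for P Q
    using that(1)
  proof induction
    case (gen B) then show ?case using 1 that(2) by simp
  next
    case (scalar c) then show ?case by (simp add: mat_commute)
  next
    case (add P Q) then show ?case by (simp add: matrix_add_ldistrib matrix_add_rdistrib)
  next
    case (mult P Q) then show ?case by (metis matrix_mul_assoc)
  qed
  then show ?thesis by (simp add: pairwise_commuting_def)
qed

lemma pairwise_commuting_vec:
  assumes "pairwise_commuting G" "P \<in> G" "Q \<in> G"
  shows "P *v (Q *v u) = Q *v (P *v u)"
  using assms by (simp add: matrix_vector_mul_assoc pairwise_commuting_def)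

section \<open>Maximal invariant subspaces\<close>

definition invariant_subspace :: "('a::field ^ 'n ^ 'n) set \<Rightarrow> ('a ^ 'n) set \<Rightarrow> bool"
  where "invariant_subspace G W \<longleftrightarrow> vec.subspace W \<and> invariant_under G W"

definition maximal_invariant :: "('a::field ^ 'n ^ 'n) set \<Rightarrow> ('a ^ 'n) set \<Rightarrow> bool"
  where "maximal_invariant G W \<longleftrightarrow> invariant_subspace G W \<and> W \<noteq> UNIV \<and>
    (\<forall>W'. invariant_subspace G W' \<and> W \<subset> W' \<longrightarrow> W' = UNIV)"

lemma alg_mem_invariant_subspace:
  assumes "invariant_subspace G W" "P \<in> generated_alg G" "u \<in> W"
  shows "P *v u \<in> W"
  using assms(2,3)
proof (induction arbitrary: u)
  case (gen A) then show ?case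
    using assms(1) by (auto simp: invariant_subspace_def invariant_under_def)
next
  case (scalar c) then show ?case
    using assms(1) by (auto simp: invariant_subspace_def mat_mult_vec vec.subspace_scale)
next
  case (add P Q) then show ?case
    using assms(1)
    by (auto simp: invariant_subspace_def matrix_vector_mult_add_rdistrib vec.subspace_add)
next
  case (mult P Q) then show ?case
    by (metis matrix_vector_mul_assoc)
qed

lemma invariant_subspaceI:
  assumes "vec.subspace W" "\<And>A u. A \<in> G \<Longrightarrow> u \<in> W \<Longrightarrow> A *v u \<in> W"
  shows "invariant_subspace G W"
  using assms by (auto simp: invariant_subspace_def invariant_under_def)

lemma dim_subspace_less:
  assumes "vec.subspace (X :: ('a::field ^ 'n) set)" "vec.subspace Y" "X \<subset> Y"
  shows "vec.dim X < vec.dim Y"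
  using assms by (metis vec.dim_psubset vec.span_eq_iff)

lemma maximal_invariant_exists:
  assumes X: "invariant_subspace G (X :: ('a::field ^ 'n) set)" "X \<noteq> UNIV"
  obtains W where "maximal_invariant G W" "X \<subseteq> W"
proof -
  let ?P = "\<lambda>W. invariant_subspace G W \<and> W \<noteq> UNIV \<and> X \<subseteq> W"
  have "\<forall>W. ?P W \<longrightarrow> vec.dim W < Suc CARD('n)"
    by (simp add: less_Suc_eq_le dim_subset_UNIV_cart_gen)
  then obtain W where W: "?P W" "\<And>W'. ?P W' \<Longrightarrow> vec.dim W' \<le> vec.dim W"
    using ex_has_greatest_nat[of ?P X vec.dim "Suc CARD('n)"] X by auto
  have "W' = UNIV" if "invariant_subspace G W'" "W \<subset> W'" for W'
    using W(1) W(2)[of W'] dim_subspace_less[of W W'] that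
    by (auto simp: invariant_subspace_def)
  with W(1) show ?thesis
    by (intro that[of W]) (auto simp: maximal_invariant_def)
qed

text \<open>
  Schur's lemma for the quotient by \<open>W\<close>: the vectors that \<open>P\<close> sends into \<open>W\<close> form an invariant
  subspace containing \<open>W\<close>, because \<open>P\<close> commutes with \<open>G\<close>. By maximality \<open>P\<close> acts on the quotient
  either injectively or as zero.
\<close>

lemma maximal_invariant_dichotomy:
  assumes G: "pairwise_commuting G" and W: "maximal_invariant G W" and P: "P \<in> generated_alg G"
    and u: "u \<notin> W" "P *v u \<in> W"
  shows "P *v x \<in> W"
proof -
  let ?K = "{x. P *v x \<in> W}"
  have inv: "invariant_subspace G W" and sub: "vec.subspace W"
    using W by (auto simp: maximal_invariant_def invariant_subspace_def)
  have "invariant_subspace G ?K"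
  proof (rule invariant_subspaceI)
    show "vec.subspace ?K"
      using sub by (auto simp: vec.subspace_def matrix_vector_right_distrib vec.scale)
  next
    fix A x assume A: "A \<in> G" and x: "x \<in> ?K"
    have "P *v (A *v x) = A *v (P *v x)"
      using pairwise_commuting_vec[OF pairwise_commuting_generated_alg[OF G] P generated_alg.gen[OF A]] .
    then show "A *v x \<in> ?K"
      using alg_mem_invariant_subspace[OF inv generated_alg.gen[OF A]] x by auto
  qed
  moreover have "W \<subset> ?K"
    using u alg_mem_invariant_subspace[OF inv P] by auto
  ultimately have "?K = UNIV"
    using W by (auto simp: maximal_invariant_def)
  then show ?thesis by auto
qed

text \<open>
  The hypothesis says that \<open>P\<close> acts injectively on the quotient by \<open>X\<close>; by dimension it then acts
  surjectively, so that the image of \<open>P\<close> and \<open>X\<close> together span the space.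
\<close>

lemma superspace_containing_image_eq_UNIV:
  assumes X: "vec.subspace (X :: ('a::field ^ 'n) set)"
    and iff: "\<And>u. P *v u \<in> X \<longleftrightarrow> u \<in> X"
    and W: "vec.subspace W" "X \<subseteq> W" "\<And>u. P *v u \<in> W"
  shows "W = UNIV"
proof -
  have "Vector_Spaces.linear (*s) (*s) (id :: 'a^'n \<Rightarrow> _)"
    by (rule vec.linear_id)
  then obtain \<pi> where \<pi>: "range \<pi> \<subseteq> X" "Vector_Spaces.linear (*s) (*s) \<pi>" "\<And>v. v \<in> X \<Longrightarrow> \<pi> v = v"
    using vec.linear_exists_left_inverse_on[of id X] X by auto
  \<comment> \<open>This map is \<open>P\<close> on the complement \<open>ker \<pi>\<close> and the identity on \<open>X\<close>, which avoids quotient spaces.\<close>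
  define L where "L v = P *v (v - \<pi> v) + \<pi> v" for v
  have lin: "Vector_Spaces.linear (*s) (*s) L"
    using \<pi>(2) unfolding Vector_Spaces.linear_iff L_def
    by (auto simp: matrix_vector_right_distrib matrix_vector_mult_diff_distrib vec.scale
        vector_ssub_ldistrib vec.scale_right_distrib)
  have "v = 0" if "L v = 0" for v
  proof -
    have "P *v (v - \<pi> v) = - \<pi> v" using that by (simp add: L_def eq_neg_iff_add_eq_0)
    then have "v - \<pi> v \<in> X"
      using \<pi>(1) iff X by (metis rangeI subsetD vec.subspace_neg)
    then have "v \<in> X"
      using \<pi>(1) X by (metis diff_add_cancel rangeI subsetD vec.subspace_add)
    then show ?thesis using that \<pi>(3) by (simp add: L_def)
  qed
  then have "inj L" using lin vec.inj_iff_eq_0 vec.linear_inj_iff_eq_0 by blast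
  then have "surj L" using lin vec.linear_inj_imp_surj by blast
  moreover have "L v \<in> W" for v
  proof -
    have "\<pi> v \<in> W" using W(2) \<pi>(1) by auto
    then show ?thesis using W by (auto simp: L_def intro!: vec.subspace_add)
  qed
  ultimately show ?thesis by (metis UNIV_eq_I surj_def)
qed

lemma range_in_maximal_invariant:
  assumes G: "pairwise_commuting G" and P: "P \<in> generated_alg G" "\<not> invertible P"
  shows "\<exists>W. maximal_invariant G W \<and> (\<forall>u. P *v u \<in> W)"
proof -
  let ?R = "range ((*v) P)"
  have "invariant_subspace G ?R"
  proof (rule invariant_subspaceI)
    show "vec.subspace ?R"
      by (metis vec.subspace_image vec.subspace_UNIV)
  next
    fix A x assume A: "A \<in> G" and "x \<in> ?R"
    then obtain y where "x = P *v y" by auto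
    then have "A *v x = P *v (A *v y)"
      by (simp only:
          pairwise_commuting_vec[OF pairwise_commuting_generated_alg[OF G] P(1) generated_alg.gen[OF A]])
    then show "A *v x \<in> ?R" by simp
  qed
  moreover have "?R \<noteq> UNIV"
    using P(2) by (simp add: invertible_right_inverse matrix_right_invertible_surjective)
  ultimately obtain W where "maximal_invariant G W" "?R \<subseteq> W"
    by (rule maximal_invariant_exists)
  then show ?thesis by auto
qed

text \<open>
  The bound on the number of subspaces is built into the choice of \<open>S\<close>: among all finite sets whose
  cardinality is at most the codimension of their intersection, take one of greatest cardinality.
  Suppose that the image of \<open>P\<close> lies in no member of \<open>S\<close>. Then \<open>P\<close> acts injectively modulo each
  member, hence modulo \<open>\<Inter>S\<close>. A maximal invariant subspace \<open>W\<close> that contains the image of \<open>P\<close> cannot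
  contain \<open>\<Inter>S\<close> as well, for it would be the whole space. So adding \<open>W\<close> to \<open>S\<close> strictly shrinks the
  intersection, and the larger set is again admissible.
\<close>

lemma finite_cover_of_noninvertible:
  fixes G :: "('a::field ^ 'n ^ 'n) set"
  assumes G: "pairwise_commuting G"
  obtains S where "finite S" "card S \<le> CARD('n)" "\<And>W. W \<in> S \<Longrightarrow> maximal_invariant G W"
    "\<And>P. P \<in> generated_alg G \<Longrightarrow> \<not> invertible P \<Longrightarrow> \<exists>W\<in>S. \<forall>u. P *v u \<in> W"
proof -
  let ?Q = "\<lambda>S. finite S \<and> (\<forall>W\<in>S. maximal_invariant G W) \<and> card S + vec.dim (\<Inter>S) \<le> CARD('n)"
  have "?Q {}" using dim_subset_UNIV_cart_gen[of UNIV] by (simp del: vec.dim_UNIV)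
  moreover have "\<forall>S. ?Q S \<longrightarrow> card S < Suc CARD('n)" by auto
  ultimately obtain S where S: "?Q S" "\<And>T. ?Q T \<Longrightarrow> card T \<le> card S"
    using ex_has_greatest_nat[of ?Q "{}" card "Suc CARD('n)"] by auto
  have sub: "vec.subspace W" if "maximal_invariant G W" for W
    using that by (auto simp: maximal_invariant_def invariant_subspace_def)
  have "\<exists>W\<in>S. \<forall>u. P *v u \<in> W" if P: "P \<in> generated_alg G" "\<not> invertible P" for P
  proof (rule ccontr)
    assume neg: "\<not> ?thesis"
    obtain W where W: "maximal_invariant G W" "\<forall>u. P *v u \<in> W"
      using range_in_maximal_invariant[OF G P] by blast
    have "P *v u \<in> Y \<longleftrightarrow> u \<in> Y" if Y: "Y \<in> S" for Y u
    proof -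
      have max: "maximal_invariant G Y" using S(1) Y by auto
      obtain x where x: "P *v x \<notin> Y" using neg Y by auto
      have "u \<in> Y" if "P *v u \<in> Y"
        using maximal_invariant_dichotomy[OF G max P(1) _ that] x by blast
      moreover have "P *v u \<in> Y" if "u \<in> Y"
        using alg_mem_invariant_subspace[OF _ P(1) that] max by (simp add: maximal_invariant_def)
      ultimately show ?thesis by blast
    qed
    then have iff: "P *v u \<in> \<Inter>S \<longleftrightarrow> u \<in> \<Inter>S" for u by blast
    have subS: "vec.subspace (\<Inter>S)" using S(1) sub by (intro vec.subspace_Inter) auto
    have "W \<noteq> UNIV" using W(1) by (simp add: maximal_invariant_def)
    then have "\<not> \<Inter>S \<subseteq> W"
      using superspace_containing_image_eq_UNIV[OF subS iff sub[OF W(1)]] W(2) by blast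
    then have "vec.dim (\<Inter>(insert W S)) < vec.dim (\<Inter>S)"
      by (intro dim_subspace_less subS vec.subspace_Inter) (use S(1) sub W(1) in auto)
    moreover have "W \<notin> S" using \<open>\<not> \<Inter>S \<subseteq> W\<close> by auto
    ultimately have "?Q (insert W S)" using S(1) W(1) by auto
    from S(2)[OF this] show False using S(1) \<open>W \<notin> S\<close> by simp
  qed
  with S(1) show ?thesis by (intro that[of S]) auto
qed

section \<open>The codimension of maximal invariant subspaces\<close>

text \<open>
  The multiplication of the type of matrices is entrywise, so \<open>poly\<close> would not give the
  value of a polynomial at a matrix.
\<close>

definition polymat :: "('a::field ^ 'n ^ 'n) \<Rightarrow> 'a poly \<Rightarrow> 'a ^ 'n ^ 'n"
  where "polymat A p = fold_coeffs (\<lambda>c M. mat c + A ** M) p 0"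

lemma mat_add_mat: "mat (a + b) = (mat a + mat b :: 'a::semiring_1 ^ 'n ^ 'n)"
  by (simp add: vec_eq_iff mat_def)

lemma polymat_0 [simp]: "polymat A 0 = 0"
  by (simp add: polymat_def)

lemma polymat_pCons [simp]: "polymat A (pCons c p) = mat c + A ** polymat A p"
  by (cases "c = 0 \<and> p = 0") (auto simp: polymat_def)

lemma polymat_add: "polymat A (p + q) = polymat A p + polymat A q"
  by (induction p q rule: poly_induct2) (simp_all add: mat_add_mat matrix_add_ldistrib)

lemma polymat_smult: "polymat A (smult c p) = mat c ** polymat A p"
proof (induction p)
  case (pCons a p)
  have "mat (c * a) = (mat c ** mat a :: 'a ^ 'b ^ 'b)"
    by (simp add: vec_eq_iff matrix_matrix_mult_def mat_def if_distrib[of "\<lambda>t. t * _"]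
        if_distrib[of "\<lambda>t. _ * t"] cong: if_cong)
  moreover have "A ** (mat c ** polymat A p) = mat c ** (A ** polymat A p)"
    by (metis mat_commute matrix_mul_assoc)
  ultimately show ?case using pCons.IH by (simp add: matrix_add_ldistrib)
qed simp

lemma polymat_mult: "polymat A (p * q) = polymat A p ** polymat A q"
proof (induction p)
  case (pCons a p)
  then show ?case
    by (simp add: polymat_add polymat_smult matrix_add_rdistrib matrix_mul_assoc)
qed simp

lemma polymat_sum: "polymat A (sum f I) = (\<Sum>i\<in>I. polymat A (f i))"
  by (induction I rule: infinite_finite_induct) (simp_all add: polymat_add)

lemma polymat_in_alg:
  assumes "A \<in> generated_alg G"
  shows "polymat A p \<in> generated_alg G"
proof (induction p)
  case 0
  show ?case using generated_alg.scalar[of 0 G] by simp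
next
  case (pCons a p)
  then show ?case using assms by (auto intro: generated_alg.intros)
qed

lemma sum_mult_vec: "(\<Sum>i\<in>I. M i) *v v = (\<Sum>i\<in>I. M i *v (v :: 'a::field ^ 'n))"
  by (induction I rule: infinite_finite_induct) (simp_all add: matrix_vector_mult_add_rdistrib)

text \<open>
  The coefficients of \<open>p\<close> come from a linear dependence of the \<open>n + 1\<close> vectors \<open>v, A v, \<dots>, A\<^sup>n v\<close>. If two
  of these vectors coincide, \<open>p\<close> is the difference of the corresponding monomials.
\<close>

lemma polymat_annihilates:
  fixes v :: "'a::field ^ 'n"
  obtains p where "p \<noteq> 0" "polymat A p *v v = 0"
proof -
  let ?x = "\<lambda>i. polymat A (monom 1 i) *v v"
  show ?thesis
  proof (cases "inj_on ?x {..CARD('n)}")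
    case False
    then obtain i j where ij: "i \<noteq> j" "?x i = ?x j" by (auto simp: inj_on_def)
    let ?p = "monom 1 i + smult (-1) (monom 1 j) :: 'a poly"
    have "coeff ?p i \<noteq> 0" using ij by simp
    then have "?p \<noteq> 0" by (metis coeff_0)
    moreover have "polymat A ?p *v v = 0"
      using ij(2) unfolding polymat_add polymat_smult
      by (simp add: matrix_vector_mult_add_rdistrib mat_mult_vec vector_smult_lneg
          flip: matrix_vector_mul_assoc)
    ultimately show ?thesis by (rule that)
  next
    case True
    let ?X = "?x ` {..CARD('n)}"
    have "card ?X = Suc CARD('n)" using True by (simp add: card_image)
    then have "\<not> vec.independent ?X"
      using vec.independent_card_le_dim[of ?X UNIV] dim_subset_UNIV_cart_gen[of "UNIV :: ('a^'n) set"]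
      by force
    then obtain u where u: "\<exists>y\<in>?X. u y \<noteq> 0" "(\<Sum>y\<in>?X. u y *s y) = 0"
      using vec.dependent_finite[of ?X] by auto
    let ?p = "\<Sum>i\<le>CARD('n). smult (u (?x i)) (monom 1 i)"
    obtain k where k: "k \<le> CARD('n)" "u (?x k) \<noteq> 0" using u(1) by auto
    have "coeff ?p k = u (?x k)"
      using k(1) by (simp add: coeff_sum if_distrib[of "\<lambda>t. _ * t"] cong: if_cong)
    then have "?p \<noteq> 0" using k(2) by (metis coeff_0)
    moreover have "polymat A ?p *v v = (\<Sum>i\<le>CARD('n). u (?x i) *s ?x i)"
      by (simp add: polymat_sum polymat_smult sum_mult_vec mat_mult_vec
          flip: matrix_vector_mul_assoc)
    moreover have "\<dots> = 0"
      using u(2) True by (simp add: sum.reindex)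
    ultimately show ?thesis using that by metis
  qed
qed

text \<open>
  On the quotient by \<open>W\<close> some nonzero polynomial in \<open>A\<close> has a kernel. Splitting off factors from \<open>D\<close>
  one at a time, one of them must have a kernel there, and then it vanishes on the quotient by the
  dichotomy for maximal invariant subspaces. The set \<open>D\<close> stands for the irreducible polynomials over
  the field in question.
\<close>

lemma polymat_divisor_into_maximal:
  fixes G :: "('a::field ^ 'n ^ 'n) set"
  assumes G: "pairwise_commuting G" and W: "maximal_invariant G W" and A: "A \<in> generated_alg G"
    and D: "\<And>p. degree p > 0 \<Longrightarrow> \<exists>d\<in>D. d dvd p \<and> degree d > 0"
  obtains d where "d \<in> D" "\<And>u. polymat A d *v u \<in> W"
proof -
  have inv: "invariant_subspace G W" and sub: "vec.subspace W" and "W \<noteq> UNIV"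
    using W by (auto simp: maximal_invariant_def invariant_subspace_def)
  have main: "\<exists>d\<in>D. \<forall>u. polymat A d *v u \<in> W"
    if "p \<noteq> 0" "v \<notin> W" "polymat A p *v v \<in> W" for p v
    using that
  proof (induction "degree p" arbitrary: p rule: less_induct)
    case less
    show ?case
    proof (cases "degree p = 0")
      case True
      then obtain c where c: "p = [:c:]" by (metis degree_eq_zeroE)
      then have "c *s v \<in> W" "c \<noteq> 0" using less.prems by (auto simp: mat_mult_vec)
      then have "inverse c *s (c *s v) \<in> W" using sub vec.subspace_scale by blast
      then show ?thesis using \<open>c \<noteq> 0\<close> less.prems by simp
    next
      case False
      then obtain d q where d: "d \<in> D" "p = d * q" "degree d > 0"
        using D[of p] unfolding dvd_def by blast
      then have *: "polymat A d *v (polymat A q *v v) \<in> W"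
        using less.prems by (simp add: polymat_mult matrix_vector_mul_assoc)
      show ?thesis
      proof (cases "polymat A q *v v \<in> W")
        case True
        have "q \<noteq> 0" "d \<noteq> 0" using d less.prems by auto
        then have "degree q < degree p" using d by (simp add: degree_mult_eq)
        then show ?thesis using less.hyps \<open>q \<noteq> 0\<close> True less.prems by blast
      next
        case False
        then show ?thesis
          using maximal_invariant_dichotomy[OF G W polymat_in_alg[OF A] False *] d(1) by blast
      qed
    qed
  qed
  obtain v where v: "v \<notin> W" using \<open>W \<noteq> UNIV\<close> by auto
  obtain p where "p \<noteq> 0" "polymat A p *v v = 0" using polymat_annihilates .
  then have "\<exists>d\<in>D. \<forall>u. polymat A d *v u \<in> W"
    using main[of p v] v vec.subspace_0[OF sub] by simp
  then show ?thesis using that by blast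
qed

lemma map_poly_of_real_add:
  "map_poly complex_of_real (p + q) = map_poly of_real p + map_poly of_real q"
  by (rule poly_eqI) (simp add: coeff_map_poly)

lemma map_poly_of_real_mult:
  "map_poly complex_of_real (p * q) = map_poly of_real p * map_poly of_real q"
  by (rule poly_eqI) (simp add: coeff_map_poly coeff_mult)

text \<open>
  By the fundamental theorem of algebra \<open>p\<close> has a complex root \<open>a + b \<i>\<close>; the factor is the minimal
  polynomial of this root over the reals.
\<close>

lemma real_poly_divisor:
  fixes p :: "real poly"
  assumes "degree p > 0"
  shows "\<exists>a b. [:a^2 + b^2, -2 * a, 1:] dvd p \<or> [:-a, 1:] dvd p"
proof -
  define q where "q = map_poly complex_of_real p"
  have "degree q > 0" using assms by (simp add: q_def degree_map_poly)
  then have "\<not> constant (poly q)" using constant_degree[of q] by simp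
  then obtain z where z: "poly q z = 0" using fundamental_theorem_of_algebra by blast
  define d where "d = (if Im z = 0 then [:- Re z, 1:] else [:(Re z)^2 + (Im z)^2, -2 * Re z, 1:])"
  have dz: "poly (map_poly complex_of_real d) z = 0"
    by (auto simp: d_def map_poly_pCons complex_eq_iff power2_eq_square algebra_simps)
  define r where "r = p mod d"
  have "p = p div d * d + r" by (simp add: r_def)
  then have "q = map_poly of_real (p div d) * map_poly of_real d + map_poly of_real r"
    unfolding q_def by (metis map_poly_of_real_add map_poly_of_real_mult)
  then have rz: "poly (map_poly complex_of_real r) z = 0" using z dz by simp
  have "r = 0"
  proof (cases "Im z = 0")
    case True
    then have "degree r = 0" using degree_mod_less[of d p] by (auto simp: r_def d_def)
    then obtain c where "r = [:c:]" by (metis degree_eq_zeroE)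
    then show ?thesis using rz by (auto simp: map_poly_pCons)
  next
    case False
    then have "degree r < 2" using degree_mod_less[of d p] by (auto simp: r_def d_def)
    then have r: "r = [:coeff r 0, coeff r 1:]"
      by (intro poly_eqI) (auto simp: coeff_pCons split: nat.splits intro!: coeff_eq_0)
    have "poly (map_poly complex_of_real [:coeff r 0, coeff r 1:]) z = 0" using rz r by simp
    then have "coeff r 1 = 0" "coeff r 0 = 0"
      using False by (auto simp: map_poly_pCons complex_eq_iff)
    then show ?thesis using r by simp
  qed
  then have "d dvd p" by (simp add: r_def dvd_eq_mod_eq_0)
  then have "[:(Re z)^2 + (Im z)^2, -2 * Re z, 1:] dvd p \<or> [:- Re z, 1:] dvd p"
    by (simp add: d_def split: if_splits)
  then show ?thesis by blast
qed

text \<open>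
  If every element of \<open>G\<close> acts on the quotient by \<open>W\<close> as \<open>x + y J\<close> for scalars \<open>x\<close>, \<open>y\<close>, and \<open>J\<^sup>2\<close> acts
  as a scalar, then \<open>W\<close>, \<open>v\<close> and \<open>J v\<close> span an invariant subspace, which is everything by maximality
  as soon as \<open>v \<notin> W\<close>. The choice \<open>J = 0\<close> covers the case where \<open>G\<close> acts by scalars.
\<close>

lemma codim_of_maximal:
  fixes G :: "('a::field ^ 'n ^ 'n) set"
  assumes W: "maximal_invariant G W"
    and J: "\<And>u. J *v (J *v u) - c *s u \<in> W" "\<And>u. u \<in> W \<Longrightarrow> J *v u \<in> W"
    and A: "\<And>A. A \<in> G \<Longrightarrow> \<exists>x y. \<forall>u. A *v u - (x *s u + y *s (J *v u)) \<in> W"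
  shows "invariant_subspace_codim_1_2 G W"
proof -
  have inv: "invariant_subspace G W" and sub: "vec.subspace W" and "W \<noteq> UNIV"
    using W by (auto simp: maximal_invariant_def invariant_subspace_def)
  then obtain v where v: "v \<notin> W" by auto
  let ?S = "vec.span (insert (J *v v) (insert v W))"
  have WS: "u \<in> W \<Longrightarrow> u \<in> ?S" for u by (auto intro: vec.span_base)
  have vS: "v \<in> ?S" "J *v v \<in> ?S" by (auto intro: vec.span_base)
  have "J *v u \<in> ?S" if "u \<in> ?S" for u
    using that
  proof (induction rule: vec.span_induct_alt)
    case (step k x y)
    have "J *v x \<in> ?S"
    proof -
      have "J *v (J *v v) - c *s v + c *s v \<in> ?S"
        using vec.span_add[OF WS[OF J(1)] vec.span_scale[OF vS(1)]] .
      then show ?thesis using step J(2) WS vS by auto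
    qed
    then show ?case using step
      by (simp add: matrix_vector_right_distrib vec.scale vec.span_add vec.span_scale)
  qed (simp add: vec.span_zero)
  note JS = this
  have "A *v u \<in> ?S" if AG: "A \<in> G" and u: "u \<in> ?S" for A u
  proof -
    obtain x y where "A *v u - (x *s u + y *s (J *v u)) \<in> W" using A[OF AG] by blast
    from vec.span_add[OF WS[OF this], of "x *s u + y *s (J *v u)"] show ?thesis
      using u JS by (auto intro: vec.span_add vec.span_scale)
  qed
  then have "invariant_subspace G ?S" by (intro invariant_subspaceI) auto
  moreover have "W \<subset> ?S" using WS vS v by blast
  ultimately have "?S = UNIV" using W by (auto simp: maximal_invariant_def)
  then have "vec.dim (insert (J *v v) (insert v W)) = CARD('n)"
    by (metis vec.dim_span vec_dim_card)
  moreover have "v \<notin> vec.span W" using v sub by (metis vec.span_eq_iff)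
  ultimately have "vec.dim W + 1 = CARD('n) \<or> vec.dim W + 2 = CARD('n)"
    by (auto simp: vec.dim_insert split: if_splits)
  then show ?thesis
    using inv by (auto simp: invariant_subspace_codim_1_2_def invariant_subspace_def)
qed

lemma codim_of_maximal_complex:
  fixes G :: "(complex ^ 'n ^ 'n) set"
  assumes G: "pairwise_commuting G" and W: "maximal_invariant G W"
  shows "invariant_subspace_codim_1_2 G W"
proof (rule codim_of_maximal[OF W])
  have sub: "vec.subspace W"
    using W by (auto simp: maximal_invariant_def invariant_subspace_def)
  show "0 *v (0 *v u) - 0 *s u \<in> W" for u using vec.subspace_0[OF sub] by simp
  show "0 *v u \<in> W" for u using vec.subspace_0[OF sub] by simp
  fix A assume A: "A \<in> G"
  have "\<exists>d\<in>range (\<lambda>a. [:-a, 1:]). d dvd p \<and> degree d > 0" if "degree p > 0" for p :: "complex poly"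
  proof -
    have "\<not> constant (poly p)" using that constant_degree[of p] by simp
    then obtain z where "poly p z = 0" using fundamental_theorem_of_algebra by blast
    then show ?thesis by (auto simp: dvd_iff_poly_eq_0 intro!: exI[of _ z])
  qed
  from polymat_divisor_into_maximal[OF G W generated_alg.gen[OF A] this]
  obtain a where "\<And>u. polymat A [:-a, 1:] *v u \<in> W" by blast
  then have "A *v u - (a *s u + 0 *s (0 *v u)) \<in> W" for u
    by (simp add: matrix_vector_mult_add_rdistrib mat_mult_vec vector_smult_lneg)
  then show "\<exists>x y. \<forall>u. A *v u - (x *s u + y *s (0 *v u)) \<in> W" by blast
qed

lemma factor_into_maximal:
  assumes G: "pairwise_commuting G" and W: "maximal_invariant G W" and "P \<in> generated_alg G"
    and PQ: "\<And>u. P *v (Q *v u) \<in> W"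
  shows "(\<forall>u. P *v u \<in> W) \<or> (\<forall>u. Q *v u \<in> W)"
  using maximal_invariant_dichotomy[OF G W assms(3) _ PQ] by blast

text \<open>
  For every \<open>A \<in> G\<close> there are real \<open>a\<close>, \<open>b\<close> such that \<open>N = A - a\<close> satisfies \<open>N\<^sup>2 + b\<^sup>2 = 0\<close> on the
  quotient by \<open>W\<close>; a linear factor of the annihilating polynomial gives \<open>b = 0\<close>. If this holds with
  \<open>b\<^sub>0 \<noteq> 0\<close> for one element \<open>A\<^sub>0 = a\<^sub>0 + N\<^sub>0\<close>, then \<open>J = N\<^sub>0 / b\<^sub>0\<close> is a complex structure on the
  quotient. Every \<open>A \<in> G\<close>, with its own \<open>a\<close> and \<open>b\<close>, then satisfies
  \<open>0 = N\<^sup>2 + b\<^sup>2 = (N - b J) (N + b J)\<close> there, and one of the factors vanishes, so \<open>A\<close> acts as the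
  complex number \<open>a + b J\<close> or \<open>a - b J\<close>. If \<open>b = 0\<close> throughout, then \<open>G\<close> acts by scalars.
\<close>

lemma codim_of_maximal_real:
  fixes G :: "(real ^ 'n ^ 'n) set"
  assumes G: "pairwise_commuting G" and W: "maximal_invariant G W"
  shows "invariant_subspace_codim_1_2 G W"
proof -
  have inv: "invariant_subspace G W" and sub: "vec.subspace W"
    using W by (auto simp: maximal_invariant_def invariant_subspace_def)
  define N where "N a A = A + mat (- a)" for a and A :: "real ^ 'n ^ 'n"
  have N_alg: "N a A \<in> generated_alg G" if "A \<in> G" for a A
    using that by (auto simp: N_def intro: generated_alg.intros)
  have N: "N a A *v u = A *v u - a *s u" for a A u
    by (simp add: N_def matrix_vector_mult_add_rdistrib mat_mult_vec vector_smult_lneg)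
  have quad: "\<exists>a b. \<forall>u. N a A *v (N a A *v u) + b^2 *s u \<in> W" if A: "A \<in> G" for A
  proof -
    have "\<exists>d\<in>{[:a^2 + b^2, -2 * a, 1:] |a b. True} \<union> range (\<lambda>a. [:-a, 1:]). d dvd p \<and> degree d > 0"
      if deg: "degree p > 0" for p :: "real poly"
    proof -
      obtain a b where "[:a^2 + b^2, -2 * a, 1:] dvd p \<or> [:-a, 1:] dvd p"
        using real_poly_divisor[OF deg] by blast
      then show ?thesis
      proof
        assume "[:a^2 + b^2, -2 * a, 1:] dvd p"
        then show ?thesis by (intro bexI[of _ "[:a^2 + b^2, -2 * a, 1:]"] conjI) auto
      next
        assume "[:-a, 1:] dvd p"
        then show ?thesis by (intro bexI[of _ "[:-a, 1:]"] conjI) auto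
      qed
    qed
    from polymat_divisor_into_maximal[OF G W generated_alg.gen[OF A] this]
    obtain d where d: "d \<in> {[:a^2 + b^2, -2 * a, 1:] |a b. True} \<union> range (\<lambda>a. [:-a, 1:])"
      "\<And>u. polymat A d *v u \<in> W" by blast
    from d(1) consider a b where "d = [:a^2 + b^2, -2 * a, 1:]" | a where "d = [:-a, 1:]" by blast
    then show ?thesis
    proof cases
      case 1
      have "N a A *v (N a A *v u) + b^2 *s u = polymat A d *v u" for u
      proof -
        have "polymat A d *v u = (a^2 + b^2) *s u + A *v ((- 2 * a) *s u + A *v u)"
          unfolding 1
          by (simp add: matrix_vector_mult_add_rdistrib mat_mult_vec flip: matrix_vector_mul_assoc)
        also have "\<dots> = (a^2 + b^2) *s u + ((- 2 * a) *s (A *v u) + A *v (A *v u))"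
          by (simp only: matrix_vector_right_distrib vec.scale)
        also have "\<dots> = A *v (A *v u) - a *s (A *v u) - a *s (A *v u - a *s u) + b^2 *s u"
          by (simp add: vec_eq_iff power2_eq_square algebra_simps)
        also have "\<dots> = N a A *v (N a A *v u) + b^2 *s u"
          by (simp only: N matrix_vector_mult_diff_distrib vec.scale)
        finally show ?thesis by simp
      qed
      then have "N a A *v (N a A *v u) + b^2 *s u \<in> W" for u using d(2) by simp
      then show ?thesis by blast
    next
      case 2
      have "N a A *v u = polymat A d *v u" for u
        unfolding N 2 by (simp add: matrix_vector_mult_add_rdistrib mat_mult_vec vector_smult_lneg)
      then have "N a A *v (N a A *v u) + 0^2 *s u \<in> W" for u using d(2) by simp
      then show ?thesis by blast
    qed
  qed
  show ?thesis
  proof (cases "\<exists>A\<in>G. \<exists>a b. b \<noteq> 0 \<and> (\<forall>u. N a A *v (N a A *v u) + b^2 *s u \<in> W)")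
    case True
    then obtain A0 a0 b0 where A0: "A0 \<in> G" "b0 \<noteq> 0"
      and q0: "\<And>u. N a0 A0 *v (N a0 A0 *v u) + b0^2 *s u \<in> W" by blast
    define J where "J = mat (1 / b0) ** N a0 A0"
    have J_alg: "J \<in> generated_alg G" unfolding J_def by (intro generated_alg.intros N_alg A0)
    have J: "J *v u = (1 / b0) *s (N a0 A0 *v u)" for u
      by (simp add: J_def mat_mult_vec flip: matrix_vector_mul_assoc)
    have JJ: "J *v (J *v u) + u \<in> W" for u
    proof -
      have "J *v (J *v u) + u = (1 / b0^2) *s (N a0 A0 *v (N a0 A0 *v u) + b0^2 *s u)"
        using A0(2) by (simp add: J vec.scale vec_eq_iff power2_eq_square field_simps)
      then show ?thesis by (simp only: vec.subspace_scale[OF sub q0])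
    qed
    show ?thesis
    proof (rule codim_of_maximal[OF W])
      show "J *v (J *v u) - (- 1) *s u \<in> W" for u using JJ[of u] by (simp add: vector_smult_lneg)
      show "J *v u \<in> W" if "u \<in> W" for u
        using alg_mem_invariant_subspace[OF inv J_alg that] .
      fix A assume A: "A \<in> G"
      obtain a b where q: "\<And>u. N a A *v (N a A *v u) + b^2 *s u \<in> W" using quad[OF A] by blast
      define P Q where "P = N a A + mat (- b) ** J" and "Q = N a A + mat b ** J"
      have P: "P *v u = N a A *v u - b *s (J *v u)" and Q: "Q *v u = N a A *v u + b *s (J *v u)" for u
        by (simp_all add: P_def Q_def matrix_vector_mult_add_rdistrib mat_mult_vec vector_smult_lneg
            flip: matrix_vector_mul_assoc)
      have P_alg: "P \<in> generated_alg G" unfolding P_def by (intro generated_alg.intros N_alg A J_alg)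
      have "P *v (Q *v u) \<in> W" for u
      proof -
        have "P *v (Q *v u) = (N a A *v (N a A *v u) + b^2 *s u) - b^2 *s (J *v (J *v u) + u)"
        proof -
          have "P *v (Q *v u) = N a A *v (N a A *v u) - b *s (J *v (N a A *v u))
              + b *s (N a A *v (J *v u) - b *s (J *v (J *v u)))"
            by (simp only: P Q matrix_vector_right_distrib vec.scale)
          moreover have "J *v (N a A *v u) = N a A *v (J *v u)"
            by (rule pairwise_commuting_vec[OF pairwise_commuting_generated_alg[OF G] J_alg N_alg[OF A]])
          ultimately show ?thesis
            by (simp add: vec_eq_iff power2_eq_square algebra_simps del: matrix_vector_mul_assoc)
        qed
        then show ?thesis
          by (simp only: vec.subspace_diff[OF sub q vec.subspace_scale[OF sub JJ]])
      qed
      then consider "\<forall>u. P *v u \<in> W" | "\<forall>u. Q *v u \<in> W"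
        using factor_into_maximal[OF G W P_alg] by blast
      then show "\<exists>x y. \<forall>u. A *v u - (x *s u + y *s (J *v u)) \<in> W"
      proof cases
        case 1
        then show ?thesis
          by (intro exI[of _ a] exI[of _ b]) (simp add: P N algebra_simps)
      next
        case 2
        then show ?thesis
          by (intro exI[of _ a] exI[of _ "- b"]) (simp add: Q N algebra_simps vector_smult_lneg)
      qed
    qed
  next
    case False
    show ?thesis
    proof (rule codim_of_maximal[OF W])
      show "0 *v (0 *v u) - 0 *s u \<in> W" for u using vec.subspace_0[OF sub] by simp
      show "0 *v u \<in> W" for u using vec.subspace_0[OF sub] by simp
      fix A assume A: "A \<in> G"
      obtain a b where q: "\<And>u. N a A *v (N a A *v u) + b^2 *s u \<in> W" using quad[OF A] by blast
      then have "b = 0" using False A by blast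
      then have "N a A *v (N a A *v u) \<in> W" for u using q[of u] by simp
      then have "\<forall>u. N a A *v u \<in> W" using factor_into_maximal[OF G W N_alg[OF A]] by blast
      then have "A *v u - (a *s u + 0 *s (0 *v u)) \<in> W" for u by (simp add: N)
      then show "\<exists>x y. \<forall>u. A *v u - (x *s u + y *s (0 *v u)) \<in> W" by blast
    qed
  qed
qed

section \<open>Closures of orbits\<close>

definition alg_orbit :: "('a::field ^ 'n ^ 'n) set \<Rightarrow> 'a ^ 'n \<Rightarrow> ('a ^ 'n) set"
  where "alg_orbit G v = (\<lambda>P. P *v v) ` generated_alg G"

lemma subspace_alg_orbit: "vec.subspace (alg_orbit G v)"
proof -
  have "0 \<in> alg_orbit G v"
    unfolding alg_orbit_def by (rule image_eqI[OF _ generated_alg.scalar[of 0]]) simp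
  moreover have "x + y \<in> alg_orbit G v" if "x \<in> alg_orbit G v" "y \<in> alg_orbit G v" for x y
  proof -
    obtain P Q where "P \<in> generated_alg G" "x = P *v v" "Q \<in> generated_alg G" "y = Q *v v"
      using \<open>x \<in> alg_orbit G v\<close> \<open>y \<in> alg_orbit G v\<close> by (auto simp: alg_orbit_def)
    then show ?thesis
      unfolding alg_orbit_def
      by (intro image_eqI[OF _ generated_alg.add[of P G Q]]) (simp_all add: matrix_vector_mult_add_rdistrib)
  qed
  moreover have "c *s x \<in> alg_orbit G v" if "x \<in> alg_orbit G v" for c x
  proof -
    obtain P where "P \<in> generated_alg G" "x = P *v v"
      using \<open>x \<in> alg_orbit G v\<close> by (auto simp: alg_orbit_def)
    then show ?thesis
      unfolding alg_orbit_def
      by (intro image_eqI[OF _ generated_alg.mult[OF generated_alg.scalar[of c G], of P]])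
        (simp_all add: mat_mult_vec flip: matrix_vector_mul_assoc)
  qed
  ultimately show ?thesis by (simp add: vec.subspace_def)
qed

lemma vec_subspace_imp_subspace:
  fixes S :: "('a::real_normed_field ^ 'n) set"
  assumes "vec.subspace S"
  shows "subspace S"
proof -
  have "r *\<^sub>R x = (of_real r :: 'a) *s x" for r and x :: "'a ^ 'n"
    by (simp add: vec_eq_iff scaleR_conv_of_real[of r "x $ i" for i])
  then show ?thesis
    using assms by (simp add: subspace_def vec.subspace_def)
qed

lemma continuous_matrix_vector:
  fixes M :: "'a::{real_normed_field, euclidean_space} ^ 'n ^ 'n"
  shows "continuous_on S (\<lambda>x. M *v x)"
  by (intro linear_continuous_on matrix_vector_mul_bounded_linear)

lemma tendsto_matrix_vector:
  fixes M :: "'a::{real_normed_field, euclidean_space} ^ 'n ^ 'n"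
  assumes "(f \<longlongrightarrow> l) F"
  shows "((\<lambda>n. M *v f n) \<longlongrightarrow> M *v l) F"
  using bounded_linear.tendsto[OF matrix_vector_mul_bounded_linear assms] .

text \<open>
  On a finite-dimensional space pointwise convergence of linear maps is convergence in operator norm.
  It suffices to look at the finitely many vectors of an orthonormal basis.
\<close>

lemma linear_tendsto_uniform:
  fixes E :: "'b::euclidean_space set" and D :: "nat \<Rightarrow> 'b \<Rightarrow> 'c::real_normed_vector"
  assumes E: "subspace E" and lin: "\<And>n. linear (D n)"
    and lim: "\<And>x. x \<in> E \<Longrightarrow> (\<lambda>n. D n x) \<longlonglongrightarrow> 0"
  obtains \<epsilon> where "\<epsilon> \<longlonglongrightarrow> 0" "\<And>n. \<epsilon> n \<ge> 0" "\<And>n x. x \<in> E \<Longrightarrow> norm (D n x) \<le> \<epsilon> n * norm x"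
proof -
  obtain B where B: "B \<subseteq> E" "pairwise orthogonal B" "\<And>x. x \<in> B \<Longrightarrow> norm x = 1"
    "independent B" "span B = E"
    using orthonormal_basis_subspace[OF E] by metis
  have "finite B" using B(4) by (rule independent_imp_finite)
  let ?e = "\<lambda>n. \<Sum>b\<in>B. norm (D n b)"
  show ?thesis
  proof (rule that[of ?e])
    show "?e \<longlonglongrightarrow> 0"
      using B(1) lim by (intro tendsto_null_sum tendsto_norm_zero) auto
    show "?e n \<ge> 0" for n by (simp add: sum_nonneg)
    fix n x assume "x \<in> E"
    then have x: "x = (\<Sum>b\<in>B. (b \<bullet> x) *\<^sub>R b)"
      using orthonormal_basis_expand[OF B(2,3) _ \<open>finite B\<close>, of x] B(5)
      by (simp add: inner_commute)
    have "D n x = (\<Sum>b\<in>B. (b \<bullet> x) *\<^sub>R D n b)"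
      by (subst x) (simp add: linear_sum[OF lin] linear_scale[OF lin])
    also have "norm \<dots> \<le> (\<Sum>b\<in>B. norm ((b \<bullet> x) *\<^sub>R D n b))" by (rule norm_sum)
    also have "\<dots> \<le> (\<Sum>b\<in>B. norm x * norm (D n b))"
    proof (rule sum_mono)
      fix b assume "b \<in> B"
      then have "\<bar>b \<bullet> x\<bar> \<le> norm x" using Cauchy_Schwarz_ineq2[of b x] B(3) by simp
      then show "norm ((b \<bullet> x) *\<^sub>R D n b) \<le> norm x * norm (D n b)"
        by (simp add: mult_right_mono)
    qed
    also have "\<dots> = ?e n * norm x" by (simp add: sum_distrib_left mult.commute)
    finally show "norm (D n x) \<le> ?e n * norm x" .
  qed
qed

text \<open>
  The maps \<open>P\<^sup>-\<^sup>1 A\<^sub>m\<close> converge to the identity on the invariant subspace \<open>\<A> v\<close>, at first only at \<open>v\<close>, then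
  pointwise by commutativity, hence in operator norm. The vectors \<open>x\<^sub>m = A\<^sub>m\<^sup>-\<^sup>1 w\<close> of the orbit of \<open>w\<close>
  lie in \<open>\<A> v\<close> and are sent to \<open>v\<close> by these maps.
\<close>

lemma orbit_closure_symmetric:
  fixes G :: "('a::{real_normed_field, euclidean_space} ^ 'n ^ 'n) set"
  assumes G: "pairwise_commuting G" and inv: "\<And>A. A \<in> G \<Longrightarrow> \<exists>B\<in>G. A ** B = mat 1"
    and P: "P \<in> generated_alg G" "invertible P" and w: "w = P *v v" "w \<in> closure (linear_orbit G v)"
  shows "v \<in> closure (linear_orbit G w)"
proof -
  obtain s where s: "\<And>n. s n \<in> linear_orbit G v" "s \<longlonglongrightarrow> w"
    using w(2) unfolding closure_sequential by blast
  then have "\<forall>n. \<exists>A. A \<in> G \<and> s n = A *v v" by (auto simp: linear_orbit_def)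
  then obtain A where A: "\<And>n. A n \<in> G" "\<And>n. s n = A n *v v" by metis
  have "\<forall>n. \<exists>B. B \<in> G \<and> A n ** B = mat 1" using inv A(1) by blast
  then obtain B where B: "\<And>n. B n \<in> G" "\<And>n. A n ** B n = mat 1" by metis
  obtain R where R: "R ** P = mat 1" using P(2) by (auto simp: invertible_def)
  have RP: "R *v (P *v x) = x" for x by (simp add: matrix_vector_mul_assoc R)
  note comm = pairwise_commuting_vec[OF pairwise_commuting_generated_alg[OF G]]
  define D where "D n x = R *v (A n *v x) - x" for n x
  have lin: "linear (D n)" for n
    unfolding D_def
    by (intro linear_compose_sub linear_ident matrix_vector_mul_linear
        linear_compose[of "(*v) (A n)" "(*v) R", unfolded o_def])
  have lim: "(\<lambda>n. D n x) \<longlonglongrightarrow> 0" if x: "x \<in> alg_orbit G v" for x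
  proof -
    obtain Q where Q: "Q \<in> generated_alg G" "x = Q *v v" using x by (auto simp: alg_orbit_def)
    have "A n *v x = Q *v s n" for n
      unfolding A(2) Q(2) by (rule comm[OF generated_alg.gen[OF A(1)] Q(1)])
    then have "(\<lambda>n. R *v (A n *v x)) \<longlonglongrightarrow> R *v (Q *v w)"
      using s(2) by (simp only: tendsto_matrix_vector)
    moreover have "R *v (Q *v w) = x"
      unfolding w(1) Q(2) by (simp only: comm[OF Q(1) P(1)] RP)
    ultimately show ?thesis
      unfolding D_def by (metis LIM_zero)
  qed
  obtain \<epsilon> where \<epsilon>: "\<epsilon> \<longlonglongrightarrow> 0" "\<And>n. \<epsilon> n \<ge> 0"
    "\<And>n x. x \<in> alg_orbit G v \<Longrightarrow> norm (D n x) \<le> \<epsilon> n * norm x"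
    using linear_tendsto_uniform[OF vec_subspace_imp_subspace[OF subspace_alg_orbit] lin lim] by metis
  define x where "x n = B n *v w" for n
  have x_orb: "x n \<in> linear_orbit G w" for n
    using B(1) by (auto simp: x_def linear_orbit_def)
  have x_alg: "x n \<in> alg_orbit G v" for n
    unfolding x_def w(1) alg_orbit_def
    by (intro image_eqI[OF _ generated_alg.mult[OF generated_alg.gen[OF B(1)] P(1)]])
      (simp add: matrix_vector_mul_assoc)
  have Dx: "D n (x n) = v - x n" for n
  proof -
    have "A n *v x n = P *v v" by (simp add: x_def w(1) matrix_vector_mul_assoc B(2) matrix_mul_assoc)
    then show ?thesis by (simp add: D_def RP)
  qed
  \<comment> \<open>The estimate \<open>norm (v - x n) \<le> \<epsilon> n * norm (x n)\<close> is of use only once \<open>x\<close> is known to be bounded.\<close>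
  have "\<forall>\<^sub>F n in sequentially. \<epsilon> n < 1 / 2"
    using order_tendstoD(2)[OF \<epsilon>(1), of "1 / 2"] by simp
  then have "\<forall>\<^sub>F n in sequentially. norm (v - x n) \<le> \<epsilon> n * (2 * norm v)"
  proof eventually_elim
    case (elim n)
    have le: "norm (v - x n) \<le> \<epsilon> n * norm (x n)" using \<epsilon>(3)[OF x_alg, of n n] Dx by simp
    also have "\<dots> \<le> 1 / 2 * norm (x n)" using elim by (intro mult_right_mono) auto
    finally have "norm (x n) \<le> 2 * norm v"
      using norm_triangle_ineq2[of "x n" v] by (simp add: norm_minus_commute)
    then show ?case using le \<epsilon>(2)[of n] by (meson mult_left_mono order_trans)
  qed
  moreover have "(\<lambda>n. \<epsilon> n * (2 * norm v)) \<longlonglongrightarrow> 0"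
    using tendsto_mult_left_zero[OF \<epsilon>(1)] .
  ultimately have "(\<lambda>n. v - x n) \<longlonglongrightarrow> 0" by (rule Lim_null_comparison)
  then have "(\<lambda>n. - (v - x n)) \<longlonglongrightarrow> - 0" by (rule tendsto_minus)
  then have "x \<longlonglongrightarrow> v" by (simp add: LIM_zero_iff)
  then show ?thesis unfolding closure_sequential using x_orb by blast
qed

text \<open>
  The vectors \<open>P v\<close> with \<open>P\<close> in the generated algebra form a linear subspace, which is closed because
  its dimension is finite.
\<close>

lemma mem_closure_orbit_alg:
  fixes G :: "('a::{real_normed_field, euclidean_space} ^ 'n ^ 'n) set"
  assumes "w \<in> closure (linear_orbit G v)"
  obtains P where "P \<in> generated_alg G" "w = P *v v"
proof -
  have "linear_orbit G v \<subseteq> alg_orbit G v"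
    by (auto simp: linear_orbit_def alg_orbit_def intro: generated_alg.gen)
  moreover have "closed (alg_orbit G v)"
    by (intro closed_subspace vec_subspace_imp_subspace subspace_alg_orbit)
  ultimately have "w \<in> alg_orbit G v" using assms closure_minimal by blast
  then show ?thesis using that by (auto simp: alg_orbit_def)
qed

lemma interior_proper_subspace:
  fixes W :: "('a::{real_normed_field, euclidean_space} ^ 'n) set"
  assumes "vec.subspace W" "W \<noteq> UNIV"
  shows "closed W" "interior W = {}"
proof -
  have sub: "subspace W" using assms by (simp add: vec_subspace_imp_subspace)
  then show "closed W" by (rule closed_subspace)
  have "dim W < DIM('a ^ 'n)"
    using dim_eq_full[of W] dim_subset_UNIV[of W] assms(2) sub
    by (metis le_neq_implies_less span_eq_iff)
  then show "interior W = {}" by (rule empty_interior_lowdim)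
qed

lemma interior_finite_Union_empty:
  assumes "finite S" "\<And>W. W \<in> S \<Longrightarrow> closed W \<and> interior W = {}"
  shows "interior (\<Union>S) = {}"
  using assms
proof (induction S)
  case (insert W S)
  then show ?case
    by (simp add: interior_closed_Un_empty_interior Un_commute)
qed simp

lemma abelian_subgroup_GL_facts:
  assumes "abelian_subgroup_GL (G :: ('a::field ^ 'n ^ 'n) set)"
  shows "pairwise_commuting G" "mat 1 \<in> G" "\<And>A B. A \<in> G \<Longrightarrow> B \<in> G \<Longrightarrow> A ** B \<in> G"
    "\<And>A. A \<in> G \<Longrightarrow> \<exists>B\<in>G. A ** B = mat 1"
proof -
  interpret subgroup G GL using assms by (simp add: abelian_subgroup_GL_def)
  interpret comm_group "GL\<lparr>carrier := G\<rparr>" using assms by (simp add: abelian_subgroup_GL_def)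
  show "pairwise_commuting G"
    using m_comm by (auto simp: pairwise_commuting_def GL_def)
  show "mat 1 \<in> G" using one_closed by (simp add: GL_def)
  show "A ** B \<in> G" if "A \<in> G" "B \<in> G" for A B
    using that m_closed by (simp add: GL_def)
  show "\<exists>B\<in>G. A ** B = mat 1" if A: "A \<in> G" for A
    using r_inv_ex[of A] A by (simp add: GL_def)
qed

text \<open>
  The complement of the subspaces from \<open>finite_cover_of_noninvertible\<close> has the required property: if
  \<open>P v\<close> avoids all of them, then \<open>P\<close> is invertible. A relatively closed invariant subset of an orbit
  closure that contains \<open>w\<close> then contains \<open>v\<close> by \<open>orbit_closure_symmetric\<close>, and so all of it.
\<close>

lemma dense_open_set_of_minimal_orbits:
  fixes G :: "('a::{real_normed_field, euclidean_space} ^ 'n ^ 'n) set"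
  assumes ab: "abelian_subgroup_GL G"
    and codim: "\<And>W. pairwise_commuting G \<Longrightarrow> maximal_invariant G W \<Longrightarrow> invariant_subspace_codim_1_2 G W"
  shows "\<exists>U. invariant_under G U \<and> open U \<and> closure U = UNIV \<and>
        (\<forall>v. linear_orbit G v \<subseteq> U \<longrightarrow> minimal_orbit_in G U (linear_orbit G v)) \<and>
        (\<exists>\<W>. finite \<W> \<and> card \<W> \<le> CARD('n) \<and>
             (\<forall>W\<in>\<W>. invariant_subspace_codim_1_2 G W) \<and> UNIV - U = \<Union>\<W>)"
proof -
  note G = abelian_subgroup_GL_facts[OF ab]
  obtain S where S: "finite S" "card S \<le> CARD('n)" "\<And>W. W \<in> S \<Longrightarrow> maximal_invariant G W"
    and cover: "\<And>P. P \<in> generated_alg G \<Longrightarrow> \<not> invertible P \<Longrightarrow> \<exists>W\<in>S. \<forall>u. P *v u \<in> W"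
    using finite_cover_of_noninvertible[OF G(1)] by metis
  define U where "U = UNIV - \<Union>S"
  have W: "vec.subspace W" "W \<noteq> UNIV" "\<And>A u. A \<in> G \<Longrightarrow> u \<in> W \<Longrightarrow> A *v u \<in> W" if "W \<in> S" for W
    using S(3)[OF that] by (auto simp: maximal_invariant_def invariant_subspace_def invariant_under_def)
  have cl: "closed W \<and> interior W = {}" if "W \<in> S" for W
    using interior_proper_subspace W[OF that] by blast
  have "open U" unfolding U_def using S(1) cl by (intro open_Diff closed_Union) auto
  have dense: "closure U = UNIV"
    using interior_finite_Union_empty[OF S(1) cl] by (simp add: U_def closure_interior Diff_Diff_Int)
  have invU: "A *v u \<in> U" if A: "A \<in> G" and u: "u \<in> U" for A u
  proof -
    obtain B where B: "B \<in> G" "A ** B = mat 1" using G(4)[OF A] by blast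
    have "B *v (A *v u) = u"
      using pairwise_commuting_vec[OF G(1) B(1) A, of u] B(2) by (simp add: matrix_vector_mul_assoc)
    then show ?thesis using u W(3)[OF _ B(1), of _ "A *v u"] by (auto simp: U_def)
  qed
  have sym: "v \<in> closure (linear_orbit G w)"
    if v: "v \<in> U" and w: "w \<in> closure (linear_orbit G v)" "w \<in> U" for v w
  proof -
    obtain P where P: "P \<in> generated_alg G" "w = P *v v" using mem_closure_orbit_alg[OF w(1)] .
    have "invertible P"
      using cover[OF P(1)] w(2) P(2) by (auto simp: U_def)
    then show ?thesis using orbit_closure_symmetric[OF G(1) G(4) P(1) _ P(2) w(1)] by blast
  qed
  have "minimal_orbit_in G U (linear_orbit G v)" if O: "linear_orbit G v \<subseteq> U" for v
  proof -
    let ?O = "linear_orbit G v"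
    have vO: "v \<in> ?O" using G(2) unfolding linear_orbit_def by (force intro: exI[of _ "mat 1"])
    have clO: "A *v u \<in> closure ?O" if A: "A \<in> G" and u: "u \<in> closure ?O" for A u
    proof -
      have "(\<lambda>x. A *v x) ` closure ?O \<subseteq> closure ?O"
      proof (rule image_closure_subset[OF continuous_matrix_vector closed_closure])
        show "(\<lambda>x. A *v x) ` ?O \<subseteq> closure ?O"
          using G(3)[OF A] closure_subset[of ?O]
          by (force simp: linear_orbit_def matrix_vector_mul_assoc)
      qed
      then show ?thesis using u by blast
    qed
    have "closed_invariant_in G U (closure ?O \<inter> U)"
      unfolding closed_invariant_in_def invariant_under_def
      using vO O closure_subset[of ?O] clO invU by (auto simp: closedin_closed_Int Int_commute)
    moreover have "F = closure ?O \<inter> U"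
      if F: "F \<subseteq> closure ?O \<inter> U" "closed_invariant_in G U F" for F
    proof
      obtain w where w: "w \<in> F" using F(2) by (auto simp: closed_invariant_in_def)
      obtain T where T: "closed T" "F = U \<inter> T"
        using F(2) unfolding closed_invariant_in_def closedin_closed by blast
      have Finv: "A *v u \<in> F" if "A \<in> G" "u \<in> F" for A u
        using F(2) that by (auto simp: closed_invariant_in_def invariant_under_def)
      have "linear_orbit G w \<subseteq> T"
        using Finv w T(2) by (auto simp: linear_orbit_def)
      then have "closure (linear_orbit G w) \<subseteq> T" using T(1) by (rule closure_minimal)
      moreover have "v \<in> U" using vO O by blast
      ultimately have "v \<in> F" using sym[of v w] w F(1) T(2) by blast
      then have "?O \<subseteq> T" using Finv T(2) by (auto simp: linear_orbit_def)
      then show "closure ?O \<inter> U \<subseteq> F" using closure_minimal[OF _ T(1)] T(2) by blast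
    qed (rule F(1))
    ultimately show ?thesis
      using O unfolding minimal_orbit_in_def minimal_set_in_def by blast
  qed
  moreover have "invariant_under G U" using invU by (auto simp: invariant_under_def)
  moreover have "UNIV - U = \<Union>S" by (auto simp: U_def)
  ultimately show ?thesis
    using \<open>open U\<close> dense S codim[OF G(1)] by blast
qed

theorem mainTheorem1:
  "(\<forall>G :: (real ^ 'n ^ 'n) set. abelian_subgroup_GL G \<longrightarrow>
     (\<exists>U :: (real ^ 'n) set.
        invariant_under G U \<and> open U \<and> closure U = UNIV \<and>
        (\<forall>v. linear_orbit G v \<subseteq> U \<longrightarrow> minimal_orbit_in G U (linear_orbit G v)) \<and>
        (\<exists>\<W>. finite \<W> \<and> card \<W> \<le> CARD('n) \<and>
             (\<forall>W\<in>\<W>. invariant_subspace_codim_1_2 G W) \<and> UNIV - U = \<Union>\<W>))) \<and>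
   (\<forall>G :: (complex ^ 'n ^ 'n) set. abelian_subgroup_GL G \<longrightarrow>
     (\<exists>U :: (complex ^ 'n) set.
        invariant_under G U \<and> open U \<and> closure U = UNIV \<and>
        (\<forall>v. linear_orbit G v \<subseteq> U \<longrightarrow> minimal_orbit_in G U (linear_orbit G v)) \<and>
        (\<exists>\<W>. finite \<W> \<and> card \<W> \<le> CARD('n) \<and>
             (\<forall>W\<in>\<W>. invariant_subspace_codim_1_2 G W) \<and> UNIV - U = \<Union>\<W>)))"
proof (intro conjI allI impI)
  fix G :: "(real ^ 'n ^ 'n) set"
  assume "abelian_subgroup_GL G"
  then show "\<exists>U. invariant_under G U \<and> open U \<and> closure U = UNIV \<and>
        (\<forall>v. linear_orbit G v \<subseteq> U \<longrightarrow> minimal_orbit_in G U (linear_orbit G v)) \<and>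
        (\<exists>\<W>. finite \<W> \<and> card \<W> \<le> CARD('n) \<and>
             (\<forall>W\<in>\<W>. invariant_subspace_codim_1_2 G W) \<and> UNIV - U = \<Union>\<W>)"
    by (rule dense_open_set_of_minimal_orbits) (rule codim_of_maximal_real)
next
  fix G :: "(complex ^ 'n ^ 'n) set"
  assume "abelian_subgroup_GL G"
  then show "\<exists>U. invariant_under G U \<and> open U \<and> closure U = UNIV \<and>
        (\<forall>v. linear_orbit G v \<subseteq> U \<longrightarrow> minimal_orbit_in G U (linear_orbit G v)) \<and>
        (\<exists>\<W>. finite \<W> \<and> card \<W> \<le> CARD('n) \<and>
             (\<forall>W\<in>\<W>. invariant_subspace_codim_1_2 G W) \<and> UNIV - U = \<Union>\<W>)"
    by (rule dense_open_set_of_minimal_orbits) (rule codim_of_maximal_complex)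
qed

end
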